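(* Define binary words $X_{-2}=X_{-1}=X_0=0$ and $X_n=X_{n-1}\overline{X_{n-3}}$ for $n\ge1$, where $\overline{\cdot}$ is the letter-wise complement $0\leftrightarrow1$, and let ${\bf aj}$ be the infinite word that is the limit of $(X_n)$ (so ${\bf aj}=011110\cdots$). Then: (1) the critical exponent of ${\bf aj}$ is $4$, and the only factors of ${\bf aj}$ of exponent $4$ are $0000$ and $1111$; (2) the asymptotic critical exponent of ${\bf aj}$ is $2$; moreover, every factor of ${\bf aj}$ of length $n$ having period $p$ satisfies $n\le 2p+2$, and there exist arbitrarily long factors of ${\bf aj}$ of length $n$ having a period $p$ with $n=2p+2$.
   Context: A finite word $w=w[0..n]$ has period $p$ ($p\ge1$) if $w[0..n-p]=w[p..n]$; the exponent of $w$ is $|w|$ divided by its smallest period, and the critical exponent of an infinite word is the supremum of exponents of its nonempty factors. If $f(n)$ denotes the smallest period among all length-$n$ factors, the asymptotic critical exponent is $\limsup_{n\to\infty} n/f(n)$. Equivalently, ${\bf aj}[n]$ (indexed from $0$) is the parity of the number of $1$'s in the Narayana representation of $n$. *)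

theory Defs
  imports Complex_Main "HOL-Library.Z2" "HOL-Library.Extended_Real" "HOL-Library.Liminf_Limsup"
begin

text \<open>Finite words are lists; an infinite word over \<open>'a\<close>, indexed from 0, is a function
  \<open>nat \<Rightarrow> 'a\<close>.\<close>

definition factor :: "'a list \<Rightarrow> (nat \<Rightarrow> 'a) \<Rightarrow> bool" where
  "factor w x \<longleftrightarrow> (\<exists>i. w = map x [i..<i + length w])"

text \<open>Note that every \<open>p \<ge> length w\<close>, with \<open>p \<ge> 1\<close>, is a period of \<open>w\<close>, as both sides of the
  equation are then empty; so the least period of a nonempty word is at most its length.\<close>

definition has_period :: "'a list \<Rightarrow> nat \<Rightarrow> bool" where
  "has_period w p \<longleftrightarrow> p \<ge> 1 \<and> take (length w - p) w = drop p w"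

definition exponent :: "'a list \<Rightarrow> real" where
  "exponent w = real (length w) / real (LEAST p. has_period w p)"

definition critical_exponent :: "(nat \<Rightarrow> 'a) \<Rightarrow> ereal" where
  "critical_exponent x = (SUP w \<in> {w. factor w x \<and> w \<noteq> []}. ereal (exponent w))"

definition min_factor_period :: "(nat \<Rightarrow> 'a) \<Rightarrow> nat \<Rightarrow> nat" where
  "min_factor_period x n = (LEAST p. \<exists>w. factor w x \<and> length w = n \<and> has_period w p)"

definition asymptotic_critical_exponent :: "(nat \<Rightarrow> 'a) \<Rightarrow> ereal" where
  "asymptotic_critical_exponent x =
     limsup (\<lambda>n. ereal (real n / real (min_factor_period x n)))"

definition word_limit :: "(nat \<Rightarrow> 'a list) \<Rightarrow> (nat \<Rightarrow> 'a) \<Rightarrow> bool" where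
  "word_limit W x \<longleftrightarrow> (\<forall>i. \<forall>\<^sub>F n in sequentially. i < length (W n) \<and> W n ! i = x i)"

definition complement :: "bit list \<Rightarrow> bit list" where
  "complement w = map (\<lambda>a. 1 + a) w"

text \<open>The index is shifted by two: \<open>Xw n\<close> is the word \<open>X\<^bsub>n-2\<^esub>\<close>. This does not affect the limit.\<close>

fun Xw :: "nat \<Rightarrow> bit list" where
  "Xw 0 = [0]"
| "Xw (Suc 0) = [0]"
| "Xw (Suc (Suc 0)) = [0]"
| "Xw (Suc (Suc (Suc n))) = Xw (Suc (Suc n)) @ complement (Xw n)"

definition aj :: "nat \<Rightarrow> bit" where
  "aj = (THE x. word_limit Xw x)"

text \<open>The limit exists and is unique, so \<open>aj\<close> is well defined.\<close>

lemma word_limit_unique: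
  assumes "word_limit W x" "word_limit W y"
  shows "x = y"
proof
  fix i
  have "\<forall>\<^sub>F n in sequentially. W n ! i = x i \<and> W n ! i = y i"
    using eventually_conj[OF assms(1)[unfolded word_limit_def, rule_format, of i]
        assms(2)[unfolded word_limit_def, rule_format, of i]]
    by (rule eventually_mono) auto
  then obtain n where "W n ! i = x i \<and> W n ! i = y i"
    by (auto simp: eventually_sequentially)
  then show "x i = y i" by metis
qed

lemma Xw_prefix_Suc: "\<exists>v. Xw (Suc n) = Xw n @ v"
  by (cases n rule: Xw.cases) auto

lemma Xw_prefix:
  assumes "m \<le> n"
  shows "\<exists>v. Xw n = Xw m @ v"
  using assms
proof (induction rule: dec_induct)
  case base
  then show ?case by simp
next
  case (step k)
  then show ?case using Xw_prefix_Suc[of k] by force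
qed

lemma length_Xw: "n < length (Xw (n + 2))"
proof (induction n)
  case 0
  then show ?case by (simp add: numeral_2_eq_2)
next
  case (Suc n)
  have "Xw n \<noteq> []" by (induction n rule: Xw.induct) auto
  then have "length (Xw n) > 0" by simp
  with Suc show ?case by (simp add: numeral_2_eq_2 complement_def del: length_greater_0_conv)
qed

lemma word_limit_Xw: "word_limit Xw (\<lambda>i. Xw (i + 2) ! i)"
  unfolding word_limit_def
proof
  fix i
  have "i < length (Xw n) \<and> Xw n ! i = Xw (i + 2) ! i" if n: "n \<ge> i + 2" for n
    using Xw_prefix[OF n] length_Xw[of i] by (auto simp: nth_append)
  then show "\<forall>\<^sub>F n in sequentially. i < length (Xw n) \<and> Xw n ! i = Xw (i + 2) ! i"
    unfolding eventually_sequentially by blast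
qed

lemma word_limit_aj: "word_limit Xw aj"
  unfolding aj_def by (rule theI[where P = "word_limit Xw", OF word_limit_Xw])
    (rule word_limit_unique[OF _ word_limit_Xw])

lemma aj_nth: "aj i = Xw (i + 2) ! i"
  using word_limit_unique[OF word_limit_aj word_limit_Xw] by (rule fun_cong)

lemma aj_prefix: "map aj [0..<6] = [0, 1, 1, 1, 1, 0]"
  by (simp add: aj_nth complement_def upt_conv_Cons eval_nat_numeral)

end

theory Submission
  imports Defs
begin

text \<open>
  The word \<open>aj\<close> is the image, under a letter coding, of the fixed point \<open>nar\<close> of the signed
  Narayana morphism \<open>a \<mapsto> ab\<close>, \<open>b \<mapsto> c\<close>, \<open>c \<mapsto> a'\<close> (the prime switches the sign). The only letters
  whose occurrences do not start a block \<open>\<phi> x\<close> are \<open>b\<close> and \<open>b'\<close>, and these are always preceded by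
  \<open>a\<close> resp. \<open>a'\<close>; hence a repetition in \<open>nar\<close> desubstitutes to a repetition closer to the origin.
  The descent shows that \<open>nar\<close> has no overlaps, and that after a square of \<open>nar\<close> even the coded bit
  breaks the period. Finally, a block of bits of \<open>aj\<close> determines the underlying letters of \<open>nar\<close>
  except for two at its left and one at its right end, so a factor of \<open>aj\<close> with period \<open>p\<close> and length
  \<open>2p + 3\<close> would contain such a square followed by the wrong bit. The bound is attained by
  the complement of \<open>X\<^bsub>k\<^esub> X\<^bsub>k\<^esub>\<close> for \<open>k\<close> divisible by 3, extended to the left by the
  last two letters of the complement of \<open>X\<^bsub>k-1\<^esub>\<close>.
\<close>

section \<open>The signed Narayana word\<close>

datatype letter = La bool | Lb bool | Lc bool

fun \<phi> :: "letter \<Rightarrow> letter list" where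
  "\<phi> (La s) = [La s, Lb s]"
| "\<phi> (Lb s) = [Lc s]"
| "\<phi> (Lc s) = [La (\<not> s)]"

text \<open>\<open>Lb s\<close> and \<open>Lc s\<close> turn into \<open>La (\<not> s)\<close> after
  two and one applications of \<open>\<phi>\<close> and already carry its bit; this encodes the
  equal initial words of the recurrence.\<close>

fun bit_of :: "letter \<Rightarrow> bool" where
  "bit_of (La s) = s"
| "bit_of (Lb s) = (\<not> s)"
| "bit_of (Lc s) = (\<not> s)"

definition subst :: "letter list \<Rightarrow> letter list" where
  "subst w = concat (map \<phi> w)"

definition Nw :: "nat \<Rightarrow> letter list" where
  "Nw n = (subst ^^ n) [La False]"

definition nar :: "nat \<Rightarrow> letter" where
  "nar k = Nw k ! k"

lemma phi_ne [simp]: "\<phi> c \<noteq> []"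
  by (cases c) auto

lemma subst_simps [simp]: "subst [] = []" "subst (c # w) = \<phi> c @ subst w"
  by (simp_all add: subst_def)

lemma subst_append [simp]: "subst (v @ w) = subst v @ subst w"
  by (simp add: subst_def)

lemma subst_eq_Nil [simp]: "subst w = [] \<longleftrightarrow> w = []"
  by (cases w) auto

lemma Nw_0: "Nw 0 = [La False]" and Nw_Suc: "Nw (Suc n) = subst (Nw n)"
  by (simp_all add: Nw_def)

text \<open>\<open>La False\<close> starts its own image, and the non-erasing \<open>subst\<close>
  preserves proper prefixes. Hence the words \<open>Nw n\<close> converge, and \<open>nar\<close> is
  their limit.\<close>

lemma Nw_extends: "\<exists>v. v \<noteq> [] \<and> Nw (Suc n) = Nw n @ v"
proof (induction n)
  case 0
  show ?case by (simp add: Nw_0 Nw_Suc)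
next
  case (Suc n)
  then obtain v where "v \<noteq> []" "Nw (Suc n) = Nw n @ v" by blast
  then have "subst (Nw (Suc n)) = subst (Nw n) @ subst v" "subst v \<noteq> []"
    by simp_all
  then show ?case unfolding Nw_Suc[symmetric] by blast
qed

lemma length_Nw: "n < length (Nw n)"
proof (induction n)
  case 0
  show ?case by (simp add: Nw_0)
next
  case (Suc n)
  obtain v where "v \<noteq> []" "Nw (Suc n) = Nw n @ v" using Nw_extends by blast
  moreover have "length v > 0" using \<open>v \<noteq> []\<close> by simp
  ultimately show ?case using Suc by (simp del: length_greater_0_conv)
qed

lemma Nw_prefix:
  assumes "m \<le> n"
  shows "\<exists>v. Nw n = Nw m @ v"
  using assms
proof (induction rule: dec_induct)
  case base
  then show ?case by simp
next
  case (step k)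
  then show ?case using Nw_extends[of k] by force
qed

lemma Nw_nth:
  assumes "k < length (Nw n)"
  shows "Nw n ! k = nar k"
proof (cases "k \<le> n")
  case True
  then show ?thesis using Nw_prefix[OF True] length_Nw[of k] by (auto simp: nar_def nth_append)
next
  case False
  then show ?thesis using Nw_prefix[of n k] assms by (auto simp: nar_def nth_append)
qed

lemma take_Nw:
  assumes "m \<le> length (Nw n)"
  shows "take m (Nw n) = map nar [0..<m]"
  using assms by (intro nth_equalityI) (auto simp: Nw_nth)

text \<open>The block \<open>\<phi> (nar k)\<close> of \<open>nar\<close> starts at position \<open>cut k\<close>.\<close>

definition cut :: "nat \<Rightarrow> nat" where
  "cut k = length (subst (map nar [0..<k]))"

text \<open>This is the fixed-point equation of \<open>nar\<close>: both \<open>Nw k\<close> and its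
  image \<open>Nw (Suc k)\<close> are prefixes of \<open>nar\<close>.\<close>

lemma subst_prefix: "subst (map nar [0..<k]) = map nar [0..<cut k]"
proof -
  have k: "k \<le> length (Nw k)" using length_Nw[of k] by simp
  have "Nw (Suc k) = subst (take k (Nw k) @ drop k (Nw k))"
    by (simp only: Nw_Suc append_take_drop_id)
  then have Y: "Nw (Suc k) = subst (map nar [0..<k]) @ subst (drop k (Nw k))"
    by (simp only: subst_append take_Nw[OF k])
  then have "cut k \<le> length (Nw (Suc k))" by (simp add: cut_def)
  from take_Nw[OF this] Y show ?thesis by (simp add: cut_def)
qed

lemma cut_Suc: "cut (Suc k) = cut k + length (\<phi> (nar k))"
  by (simp add: cut_def)

lemma cut_0 [simp]: "cut 0 = 0"
  by (simp add: cut_def)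

lemma subst_factor: "subst (map nar [k..<k + n]) = map nar [cut k..<cut (k + n)]"
proof -
  have "map nar [0..<cut (k + n)] = map nar [0..<cut k] @ subst (map nar [k..<k + n])"
    unfolding subst_prefix[symmetric] by (simp add: upt_add_eq_append[of 0 k n])
  moreover have "cut k \<le> cut (k + n)"
    unfolding cut_def by (simp add: upt_add_eq_append[of 0 k n])
  then have "map nar [0..<cut (k + n)] = map nar [0..<cut k] @ map nar [cut k..<cut (k + n)]"
    using upt_add_eq_append[of 0 "cut k" "cut (k + n) - cut k"] by simp
  ultimately show ?thesis by simp
qed

lemma phi_nar: "\<phi> (nar k) = map nar [cut k..<cut (Suc k)]"
  using subst_factor[of k 1] by simp

lemma nar_0: "nar 0 = La False"
  by (simp add: nar_def Nw_0)

lemma nar_cut_La: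
  assumes "nar k = La s"
  shows "nar (cut k) = La s \<and> nar (Suc (cut k)) = Lb s \<and> cut (Suc k) = cut k + 2"
proof -
  have "cut (Suc k) = cut k + 2" using assms by (simp add: cut_Suc)
  then show ?thesis using phi_nar[of k] assms by (simp add: upt_conv_Cons)
qed

lemma nar_cut_Lb:
  assumes "nar k = Lb s"
  shows "nar (cut k) = Lc s \<and> cut (Suc k) = cut k + 1"
proof -
  have "cut (Suc k) = cut k + 1" using assms by (simp add: cut_Suc)
  then show ?thesis using phi_nar[of k] assms by (simp add: upt_conv_Cons)
qed

lemma nar_cut_Lc:
  assumes "nar k = Lc s"
  shows "nar (cut k) = La (\<not> s) \<and> cut (Suc k) = cut k + 1"
proof -
  have "cut (Suc k) = cut k + 1" using assms by (simp add: cut_Suc)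
  then show ?thesis using phi_nar[of k] assms by (simp add: upt_conv_Cons)
qed

section \<open>Recognising a letter from its block\<close>

lemma nar_cut_hd: "nar (cut k) = hd (\<phi> (nar k))"
  using nar_cut_La[of k] nar_cut_Lb[of k] nar_cut_Lc[of k] by (cases "nar k") simp_all

lemma nar_cut_neq_Lb [simp]: "nar (cut k) \<noteq> Lb s"
  by (cases "nar k") (auto simp: nar_cut_hd)

lemma nar_cut_eq_La: "nar (cut k) = La s \<Longrightarrow> nar k = La s \<or> nar k = Lc (\<not> s)"
  by (cases "nar k") (auto simp: nar_cut_hd)

lemma nar_cut_eq_Lc: "nar (cut k) = Lc s \<Longrightarrow> nar k = Lb s"
  by (cases "nar k") (auto simp: nar_cut_hd)

text \<open>A block starting with \<open>La\<close> is either the image of an \<open>La\<close>,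
  which continues with \<open>Lb\<close>, or the one-letter image of an \<open>Lc\<close>.\<close>

lemma nar_cut_next:
  assumes "nar (cut k) = La s" "nar (Suc (cut k)) \<noteq> Lb s"
  shows "nar k = Lc (\<not> s)"
  using nar_cut_eq_La[OF assms(1)] nar_cut_La[of k s] assms(2) by blast

lemma nar_cut_next_Lb:
  assumes "nar (Suc (cut k)) = Lb s"
  shows "nar k = La s"
proof (cases "nar k")
  case (La x)
  then show ?thesis using assms nar_cut_La by fastforce
next
  case (Lb x)
  then have "Suc (cut k) = cut (Suc k)" using nar_cut_Lb by simp
  then show ?thesis using assms by (metis nar_cut_neq_Lb)
next
  case (Lc x)
  then have "Suc (cut k) = cut (Suc k)" using nar_cut_Lc by simp
  then show ?thesis using assms by (metis nar_cut_neq_Lb)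
qed

lemma cut_less_Suc: "cut k < cut (Suc k)"
  by (simp add: cut_Suc)

lemma strict_mono_cut: "strict_mono cut"
  by (simp add: strict_mono_Suc_iff cut_less_Suc)

lemma cut_eq_iff [simp]: "cut i = cut j \<longleftrightarrow> i = j"
  using strict_mono_cut by (simp add: strict_mono_eq)

text \<open>The first block has length two and no block is empty. Strictness makes positions
  decrease under desubstitution, which drives the descents below.\<close>

lemma less_cut: "0 < k \<Longrightarrow> k < cut k"
proof (induction k)
  case (Suc k)
  show ?case
  proof (cases "k = 0")
    case True
    then show ?thesis using nar_cut_La[OF nar_0] by simp
  next
    case False
    then show ?thesis using Suc cut_less_Suc[of k] by simp
  qed
qed simp

lemma cut_cover: "\<exists>k. m = cut k \<or> (m = Suc (cut k) \<and> (\<exists>s. nar k = La s))"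
proof (induction m)
  case 0
  show ?case by (rule exI[of _ 0]) simp
next
  case (Suc m)
  then obtain k where k: "m = cut k \<or> (m = Suc (cut k) \<and> (\<exists>s. nar k = La s))" by blast
  show ?case
  proof (cases "m = cut k \<and> (\<exists>s. nar k = La s)")
    case False
    then have "Suc m = cut (Suc k)"
      using k by (cases "nar k") (auto simp: cut_Suc)
    then show ?thesis by blast
  qed blast
qed

lemma block_start:
  assumes "\<And>s. nar m \<noteq> Lb s"
  obtains k where "m = cut k"
  using cut_cover[of m] assms nar_cut_La by metis

lemma before_Lb:
  assumes "nar k = Lb s"
  shows "0 < k \<and> nar (k - 1) = La s"
proof -
  obtain l t where "k = Suc (cut l)" "nar l = La t"
    using cut_cover[of k] assms nar_cut_neq_Lb by metis
  then show ?thesis using assms nar_cut_La[of l t] by auto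
qed

text \<open>An \<open>Lc\<close> is the image of an \<open>Lb\<close>; the \<open>La\<close> before
  that \<open>Lb\<close> has an image ending in \<open>Lb\<close>.\<close>

lemma before_Lc:
  assumes "nar k = Lc s"
  shows "0 < k \<and> nar (k - 1) = Lb s"
proof -
  obtain l where l: "k = cut l"
    using block_start[of k] assms by auto
  then have "nar l = Lb s" using assms nar_cut_eq_Lc by simp
  from before_Lb[OF this] obtain m where "l = Suc m" "nar m = La s"
    by (cases l) auto
  then show ?thesis using l nar_cut_La[of m s] by auto
qed

lemma before_Suc_Lb: "nar (Suc k) = Lb s \<Longrightarrow> nar k = La s"
  using before_Lb[of "Suc k"] by simp

lemma before_Suc_Lc: "nar (Suc k) = Lc s \<Longrightarrow> nar k = Lb s"
  using before_Lc[of "Suc k"] by simp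

section \<open>Repetitions in the Narayana word\<close>

definition run :: "nat \<Rightarrow> nat \<Rightarrow> nat \<Rightarrow> bool" where
  "run i j n \<longleftrightarrow> (\<forall>t<n. nar (i + t) = nar (j + t))"

lemma run_D: "run i j n \<Longrightarrow> t < n \<Longrightarrow> nar (i + t) = nar (j + t)"
  by (simp add: run_def)

lemma run_0: "run i j n \<Longrightarrow> 0 < n \<Longrightarrow> nar i = nar j"
  using run_D[of i j n 0] by simp

lemma run_mono: "run i j n \<Longrightarrow> m \<le> n \<Longrightarrow> run i j m"
  by (simp add: run_def)

lemma run_Suc: "run i j (Suc n) \<longleftrightarrow> run i j n \<and> nar (i + n) = nar (j + n)"
  by (auto simp: run_def less_Suc_eq)

lemma run_Cons: "run i j (Suc n) \<longleftrightarrow> nar i = nar j \<and> run (Suc i) (Suc j) n"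
  by (simp add: run_def All_less_Suc2)

text \<open>Blocks are peeled off one at a time, each identified by two letters. The conditions at
  the two ends keep the last block from being cut between \<open>La\<close> and
  \<open>Lb\<close>.\<close>

lemma desubstitute_blocks:
  assumes "run (cut i) (cut j) n"
    and "\<And>s. nar (cut i + n) \<noteq> Lb s" "\<And>s. nar (cut j + n) \<noteq> Lb s"
  shows "\<exists>m. cut (i + m) = cut i + n \<and> cut (j + m) = cut j + n \<and> run i j m"
  using assms
proof (induction n arbitrary: i j rule: less_induct)
  case (less n)
  show ?case
  proof (cases "n = 0")
    case True
    then show ?thesis by (intro exI[of _ 0]) (simp add: run_def)
  next
    case False
    have eq0: "nar (cut i) = nar (cut j)" using run_0[OF less.prems(1)] False by simp
    \<comment> \<open>For \<open>n = 1\<close> the second letters lie beyond the run, where the end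
      conditions exclude \<open>Lb\<close> on both sides.\<close>
    have eq1: "nar (Suc (cut i)) = Lb s \<longleftrightarrow> nar (Suc (cut j)) = Lb s" for s
    proof (cases "n = 1")
      case True
      then show ?thesis using less.prems(2,3) by simp
    next
      case nn: False
      then show ?thesis using run_D[OF less.prems(1), of 1] False by simp
    qed
    have eq: "nar i = nar j"
    proof (cases "nar i")
      case (La s)
      then show ?thesis using eq1[of s] nar_cut_La[of i s] nar_cut_next_Lb[of j s] by simp
    next
      case (Lb s)
      then show ?thesis using eq0 nar_cut_Lb[of i s] nar_cut_eq_Lc[of j s] by simp
    next
      case (Lc s)
      then have "nar (Suc (cut i)) \<noteq> Lb (\<not> s)"
        using nar_cut_next_Lb[of i "\<not> s"] by auto
      moreover have "nar (cut j) = La (\<not> s)" using eq0 nar_cut_Lc[OF Lc] by simp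
      ultimately show ?thesis using eq1[of "\<not> s"] nar_cut_next[of j "\<not> s"] Lc by simp
    qed
    define l where "l = length (\<phi> (nar i))"
    have gl: "cut (Suc i) = cut i + l" "cut (Suc j) = cut j + l"
      using eq by (simp_all add: cut_Suc l_def)
    have l: "0 < l" by (simp add: l_def)
    have "l \<le> n"
    proof (cases "nar i")
      case (La s)
      then have "n \<noteq> 1" using nar_cut_La[of i s] less.prems(2)[of s] by auto
      then show ?thesis using La False by (simp add: l_def)
    qed (use False in \<open>auto simp: l_def\<close>)
    have "run (cut (Suc i)) (cut (Suc j)) (n - l)"
      unfolding run_def
    proof (intro allI impI)
      fix t assume "t < n - l"
      then show "nar (cut (Suc i) + t) = nar (cut (Suc j) + t)"
        using run_D[OF less.prems(1), of "l + t"] by (simp add: gl add.assoc)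
    qed
    moreover have "cut (Suc i) + (n - l) = cut i + n" "cut (Suc j) + (n - l) = cut j + n"
      using gl \<open>l \<le> n\<close> by simp_all
    moreover have "n - l < n" using l False by simp
    ultimately obtain m where
      m: "cut (Suc i + m) = cut i + n" "cut (Suc j + m) = cut j + n" "run (Suc i) (Suc j) m"
      using less.IH[of "n - l" "Suc i" "Suc j"] less.prems(2,3) by metis
    then show ?thesis using eq by (intro exI[of _ "Suc m"]) (simp add: run_Cons)
  qed
qed

lemma desubstitute:
  assumes "run i j n"
    and "nar i \<notin> range Lb" "nar j \<notin> range Lb"
    and "nar (i + n) \<notin> range Lb" "nar (j + n) \<notin> range Lb"
  obtains i' j' m where "i = cut i'" "j = cut j'" "i + n = cut (i' + m)" "j + n = cut (j' + m)"
    "run i' j' m"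
proof -
  obtain i' where i: "i = cut i'" using block_start[of i] assms(2) by blast
  obtain j' where j: "j = cut j'" using block_start[of j] assms(3) by blast
  have "\<exists>m. cut (i' + m) = cut i' + n \<and> cut (j' + m) = cut j' + n \<and> run i' j' m"
    using assms i j by (intro desubstitute_blocks) auto
  then show thesis using that[OF i j] i j by metis
qed

text \<open>Each of the next five configurations desubstitutes to the one before it, and the first is
  impossible because its desubstitution would make \<open>a\<close> and \<open>b\<close> agree.\<close>

lemma no_run_a_c:
  assumes "run i j n" "j = Suc (i + n)" "nar (i + n) = La s" "nar (j + n) = Lc (\<not> s)"
    and "nar i \<notin> range Lb" "nar j \<notin> range Lb"
  shows False
proof -
  have nb: "nar i \<notin> range Lb" "nar j \<notin> range Lb"
    "nar (i + n) \<notin> range Lb" "nar (j + n) \<notin> range Lb"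
    using assms by auto
  obtain i' j' m where d: "i = cut i'" "j = cut j'" "i + n = cut (i' + m)" "j + n = cut (j' + m)"
    "run i' j' m"
    by (rule desubstitute[OF assms(1) nb])
  have im: "nar (i' + m) = Lc (\<not> s)"
    using nar_cut_next[of "i' + m" s] d assms(2,3,6) by auto
  \<comment> \<open>The image of \<open>Lc\<close> is a single letter, so the gap between the two
    desubstituted stretches is again one letter.\<close>
  then have "j = cut (Suc (i' + m))" using nar_cut_Lc[OF im] assms(2) d(3) by simp
  then have j': "j' = Suc (i' + m)" using d(2) by simp
  have jm: "nar (j' + m) = Lb (\<not> s)" using nar_cut_eq_Lc d(4) assms(4) by simp
  show False
  proof (cases m)
    case 0
    then show ?thesis using im jm j' before_Suc_Lb by fastforce
  next
    case (Suc m')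
    then have "nar (j' + m') = La (\<not> s)" "nar (i' + m') = Lb (\<not> s)"
      using im jm before_Suc_Lb[of "j' + m'"] before_Suc_Lc[of "i' + m'"] by simp_all
    then show ?thesis using run_D[OF d(5), of m'] Suc by simp
  qed
qed

lemma no_run_b_a:
  assumes "run i j n" "j = Suc (i + n)" "nar (i + n) = Lb s" "nar (j + n) = La (\<not> s)"
    and "nar i = La s" "nar j = La s"
  shows False
proof -
  obtain n' where n: "n = Suc n'" using assms by (cases n) auto
  \<comment> \<open>The run is shortened by one letter so that both stretches end just before an
    \<open>La\<close>, as \<open>desubstitute\<close> requires.\<close>
  have a: "nar (i + n') = La s" using before_Suc_Lb assms(3) n by simp
  have b: "nar (j + n') = La s" using run_D[OF assms(1), of n'] a n by simp
  have rn: "run i j n'" using run_mono[OF assms(1)] n by simp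
  have nb: "nar i \<notin> range Lb" "nar j \<notin> range Lb"
    "nar (i + n') \<notin> range Lb" "nar (j + n') \<notin> range Lb"
    using assms a b by auto
  obtain i' j' m where d: "i = cut i'" "j = cut j'" "i + n' = cut (i' + m)" "j + n' = cut (j' + m)"
    "run i' j' m"
    by (rule desubstitute[OF rn nb])
  have "nar (Suc (cut (i' + m))) = Lb s" using assms(3) n d(3) by (metis add_Suc_right)
  then have im: "nar (i' + m) = La s" by (rule nar_cut_next_Lb)
  then have "j = cut (Suc (i' + m))" using nar_cut_La[OF im] assms(2) n d(3) by simp
  then have j': "j' = Suc (i' + m)" using d(2) by simp
  have "nar (Suc (cut (j' + m))) = La (\<not> s)" using assms(4) n d(4) by (metis add_Suc_right)
  then have jm: "nar (j' + m) = Lc (\<not> s)" using nar_cut_next[of "j' + m" s] b d(4) by simp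
  have "nar i' \<notin> range Lb" "nar j' \<notin> range Lb"
    using assms(5,6) d(1,2) nar_cut_eq_La[of i' s] nar_cut_eq_La[of j' s] by auto
  then show False using no_run_a_c[OF d(5) j' im jm] by blast
qed

lemma no_run_c_a:
  assumes "run i j n" "j = Suc (i + n)" "nar (i + n) = Lc s" "nar (j + n) = La (\<not> s)"
    and "nar i = La s" "nar j = La s"
  shows False
proof -
  have nb: "nar i \<notin> range Lb" "nar j \<notin> range Lb"
    "nar (i + n) \<notin> range Lb" "nar (j + n) \<notin> range Lb"
    using assms by auto
  obtain i' j' m where d: "i = cut i'" "j = cut j'" "i + n = cut (i' + m)" "j + n = cut (j' + m)"
    "run i' j' m"
    by (rule desubstitute[OF assms(1) nb])
  have im: "nar (i' + m) = Lb s" using nar_cut_eq_Lc d(3) assms(3) by simp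
  then have "j = cut (Suc (i' + m))" using nar_cut_Lb[OF im] assms(2) d(3) by simp
  then have j': "j' = Suc (i' + m)" using d(2) by simp
  obtain m' where m: "m = Suc m'" using assms d by (cases m) auto
  have "nar (i' + m') = La s" using before_Suc_Lb im m by simp
  then have "nar (j' + m') = La s" using run_D[OF d(5), of m'] m by simp
  then have "nar (j' + m) \<noteq> Lc s" using before_Suc_Lc[of "j' + m'" s] m by auto
  then have jm: "nar (j' + m) = La (\<not> s)"
    using nar_cut_eq_La[of "j' + m" "\<not> s"] d(4) assms(4) by simp
  \<comment> \<open>An \<open>Lc (\<not> s)\<close> at \<open>j'\<close> would need
    \<open>Lb (\<not> s)\<close> before it, but the letter there is \<open>Lb s\<close>.\<close>
  have "nar j' \<noteq> Lc (\<not> s)" using before_Suc_Lc[of "i' + m" "\<not> s"] im j' by auto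
  then have yj: "nar j' = La s" using nar_cut_eq_La[of j' s] d(2) assms(6) by simp
  then have "nar i' = La s" using run_0[OF d(5)] m by simp
  then show False using no_run_b_a[OF d(5) j' im jm _ yj] by blast
qed

lemma no_square_b:
  assumes "run i j n" "j = i + n" "nar i = La s" "nar j = La s" "nar (j + n) = Lb (\<not> s)"
  shows False
proof -
  obtain n' where n: "n = Suc n'" using assms by (cases n) auto
  have b: "nar (j + n') = La (\<not> s)" using before_Suc_Lb assms(5) n by simp
  have a: "nar (i + n') = La (\<not> s)" using run_D[OF assms(1), of n'] b n by simp
  have rn: "run i j n'" using run_mono[OF assms(1)] n by simp
  have nb: "nar i \<notin> range Lb" "nar j \<notin> range Lb"
    "nar (i + n') \<notin> range Lb" "nar (j + n') \<notin> range Lb"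
    using assms a b by auto
  obtain i' j' m where d: "i = cut i'" "j = cut j'" "i + n' = cut (i' + m)" "j + n' = cut (j' + m)"
    "run i' j' m"
    by (rule desubstitute[OF rn nb])
  \<comment> \<open>The second half starts right after this \<open>La (\<not> s)\<close>, which
    therefore is the image of an \<open>Lc\<close>. That \<open>Lc\<close> becomes a gap, so the
    square turns into the configuration of \<open>no_run_c_a\<close>.\<close>
  have "nar (Suc (cut (i' + m))) = La s" using assms(2,4) n d(3) by (metis add_Suc_right)
  then have im: "nar (i' + m) = Lc s" using nar_cut_next[of "i' + m" "\<not> s"] a d(3) by simp
  then have "j = cut (Suc (i' + m))" using nar_cut_Lc[OF im] assms(2) n d(3) by simp
  then have j': "j' = Suc (i' + m)" using d(2) by simp
  have "nar (Suc (cut (j' + m))) = Lb (\<not> s)" using assms(5) n d(4) by (metis add_Suc_right)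
  then have jm: "nar (j' + m) = La (\<not> s)" by (rule nar_cut_next_Lb)
  have "nar j' \<noteq> Lc (\<not> s)" using before_Suc_Lc[of "i' + m" "\<not> s"] im j' by auto
  then have yj: "nar j' = La s" using nar_cut_eq_La[of j' s] d(2) assms(4) by simp
  then have "0 < m" using jm by (cases m) auto
  then have "nar i' = La s" using run_0[OF d(5)] yj by simp
  then show False using no_run_c_a[OF d(5) j' im jm _ yj] by blast
qed

lemma no_square_c:
  assumes "run i j n" "j = i + n" "0 < n" "nar i = La s" "nar j = La s" "nar (j + n) = Lc (\<not> s)"
  shows False
proof -
  have nb: "nar i \<notin> range Lb" "nar j \<notin> range Lb"
    "nar (i + n) \<notin> range Lb" "nar (j + n) \<notin> range Lb"
    using assms by auto
  obtain i' j' m where d: "i = cut i'" "j = cut j'" "i + n = cut (i' + m)" "j + n = cut (j' + m)"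
    "run i' j' m"
    by (rule desubstitute[OF assms(1) nb])
  have j': "j' = i' + m" using d assms(2) by simp
  have "m \<noteq> 0" using d(1,3) assms(3) by (metis add.right_neutral add_eq_self_zero not_less0)
  then obtain m' where m: "m = Suc m'" by (cases m) auto
  have jm: "nar (j' + m) = Lb (\<not> s)" using nar_cut_eq_Lc d(4) assms(6) by simp
  then have "nar (j' + m') = La (\<not> s)" using before_Suc_Lb m by simp
  then have "nar (i' + m') = La (\<not> s)" using run_D[OF d(5), of m'] m by simp
  then have "nar j' \<noteq> Lc (\<not> s)" using before_Suc_Lc[of "i' + m'" "\<not> s"] j' m by auto
  then have yj: "nar j' = La s" using nar_cut_eq_La[of j' s] d(2) assms(5) by simp
  then have "nar i' = La s" using run_0[OF d(5)] m by simp
  then show False using no_square_b[OF d(5) j' _ yj jm] by blast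
qed

text \<open>Descent on \<open>j\<close>: an overlap starting with \<open>Lb\<close> extends to the
  left; any other desubstitutes to a square nearer the origin, which gives an overlap there or
  contradicts \<open>no_square_c\<close>.\<close>

theorem overlap_free:
  assumes "0 < n" "j = i + n"
  shows "\<not> run i j (Suc n)"
  using assms
proof (induction j arbitrary: i n rule: less_induct)
  case (less j)
  show ?case
  proof
    assume r: "run i j (Suc n)"
    \<comment> \<open>\<open>Lb\<close> and \<open>Lc\<close> force their predecessor, so a square
      starting with one of them, with the same letter at both starts, yields an overlap one position
      earlier.\<close>
    have shift: False if "0 < n'" "j' = i' + n'" "j' \<le> j" "run i' j' n'" "nar j' = nar i'"
      "(\<exists>s. nar i' = Lb s) \<or> (\<exists>s. nar i' = Lc s)" for i' j' n'
    proof -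
      have "0 < i'" "0 < j'" "nar (i' - 1) = nar (j' - 1)"
        using that(5,6) before_Lb[of i'] before_Lb[of j'] before_Lc[of i'] before_Lc[of j'] by auto
      then have "run (i' - 1) (j' - 1) (Suc n')" using that(4) by (simp add: run_Cons)
      moreover have "j' - 1 < j" "j' - 1 = i' - 1 + n'" using that(2,3) \<open>0 < i'\<close> by auto
      ultimately show False using less.IH[of "j' - 1" n' "i' - 1"] that(1) by blast
    qed
    have rn: "run i j n" and jn: "nar (j + n) = nar i" and ji: "nar j = nar i"
      using r less.prems run_0[OF r] by (simp_all add: run_Suc)
    have "nar i \<notin> range Lb"
      using shift[OF less.prems(1,2) order_refl rn ji] by blast
    then have nb: "nar i \<notin> range Lb" "nar j \<notin> range Lb"
      "nar (i + n) \<notin> range Lb" "nar (j + n) \<notin> range Lb"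
      using jn ji less.prems(2) by simp_all
    obtain i' j' m where d: "i = cut i'" "j = cut j'" "i + n = cut (i' + m)" "j + n = cut (j' + m)"
      "run i' j' m"
      by (rule desubstitute[OF rn nb])
    have j': "j' = i' + m" using d less.prems by simp
    have "m \<noteq> 0" using d(1,3) less.prems(1) by (metis add.right_neutral add_eq_self_zero not_less0)
    then have m: "0 < m" by simp
    have lt: "j' < j" using less_cut[of j'] j' m d(2) by simp
    have ij': "nar i' = nar j'" using run_0[OF d(5) m] .
    have "nar (j' + m) \<noteq> nar i'"
      using less.IH[OF lt m j'] d(5) ij' j' by (simp add: run_Suc)
    moreover have "nar (cut i') = nar (cut (j' + m))" using d(1,4) jn by simp
    \<comment> \<open>Two different letters whose blocks begin alike are \<open>La s\<close> and
      \<open>Lc (\<not> s)\<close>, in one order or the other.\<close>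
    ultimately obtain s where "nar i' = La s \<and> nar (j' + m) = Lc (\<not> s) \<or> nar i' = Lc (\<not> s)"
      by (cases "nar i'"; cases "nar (j' + m)") (auto simp: nar_cut_hd)
    then show False
      using no_square_c[OF d(5) j' m, of s] shift[OF m j' _ d(5)] ij' lt by auto
  qed
qed

text \<open>Extending to the left excludes squares starting with \<open>Lb\<close> or
  \<open>Lc\<close>. After a square starting with \<open>La s\<close>, overlap-freeness excludes
  \<open>La s\<close>; the other letters with its bit, \<open>Lb (\<not> s)\<close> and
  \<open>Lc (\<not> s)\<close>, are excluded by \<open>no_square_b\<close> and
  \<open>no_square_c\<close>.\<close>

theorem square_right_bit:
  assumes "run i j n" "j = i + n" "0 < n"
  shows "bit_of (nar (j + n)) \<noteq> bit_of (nar j)"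
proof
  assume bit: "bit_of (nar (j + n)) = bit_of (nar j)"
  have ij: "nar i = nar j" using run_0[OF assms(1,3)] .
  have neq: "nar j \<noteq> nar (j + n)"
    using overlap_free[OF assms(3,2)] assms(1,2) by (simp add: run_Suc)
  have "\<not> ((\<exists>s. nar i = Lb s) \<or> (\<exists>s. nar i = Lc s))"
  proof
    assume "(\<exists>s. nar i = Lb s) \<or> (\<exists>s. nar i = Lc s)"
    then have "0 < i" "0 < j" "nar (i - 1) = nar (j - 1)"
      using ij before_Lb[of i] before_Lb[of j] before_Lc[of i] before_Lc[of j] by auto
    then have "run (i - 1) (j - 1) (Suc n)" using assms(1) by (simp add: run_Cons)
    then show False using overlap_free[of n "j - 1" "i - 1"] assms \<open>0 < i\<close> by simp
  qed
  then obtain s where s: "nar i = La s" by (cases "nar i") auto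
  then show False
    using bit neq ij no_square_b[OF assms(1,2) s] no_square_c[OF assms s]
    by (cases "nar (j + n)") auto
qed

section \<open>Decoding the bits of the Allouche--Johnson word\<close>

fun flip :: "letter \<Rightarrow> letter" where
  "flip (La s) = La (\<not> s)"
| "flip (Lb s) = Lb (\<not> s)"
| "flip (Lc s) = Lc (\<not> s)"

lemma subst_map_flip: "subst (map flip w) = map flip (subst w)"
proof (induction w)
  case (Cons c w)
  then show ?case by (cases c) simp_all
qed simp

lemma funpow_subst_flip: "(subst ^^ n) (map flip w) = map flip ((subst ^^ n) w)"
  by (induction n) (simp_all add: subst_map_flip)

lemma funpow_subst_append: "(subst ^^ n) (v @ w) = (subst ^^ n) v @ (subst ^^ n) w"
  by (induction n) simp_all

text \<open>One application of \<open>subst\<close> sends \<open>a\<close> to \<open>ab\<close>, two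
  send \<open>b\<close> to \<open>a'\<close>, and \<open>flip\<close> commutes with
  \<open>subst\<close>. This is the recurrence of \<open>Xw\<close> at the level of letters.\<close>

lemma Nw_rec: "Nw (Suc (Suc (Suc n))) = Nw (Suc (Suc n)) @ map flip (Nw n)"
proof -
  have "Nw (Suc (Suc (Suc n))) = (subst ^^ Suc (Suc n)) ([La False] @ [Lb False])"
    by (simp add: Nw_def funpow_Suc_right del: funpow.simps)
  also have "\<dots> = Nw (Suc (Suc n)) @ (subst ^^ Suc (Suc n)) [Lb False]"
    by (simp only: Nw_def funpow_subst_append)
  also have "(subst ^^ Suc (Suc n)) [Lb False] = (subst ^^ n) (map flip [La False])"
    by (simp add: funpow_Suc_right del: funpow.simps)
  finally show ?thesis by (simp only: funpow_subst_flip Nw_def)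
qed

lemma complement_simps [simp]:
  "complement [] = []" "complement (a # w) = (1 + a) # complement w"
  "complement (v @ w) = complement v @ complement w"
  "length (complement w) = length w"
  by (simp_all add: complement_def)

lemma of_bool_bit_of_flip: "of_bool (bit_of (flip c)) = (1 + of_bool (bit_of c) :: bit)"
  by (cases c) auto

lemma Xw_eq_Nw: "Xw (Suc (Suc n)) = map (\<lambda>c. of_bool (bit_of c)) (Nw n)"
proof (induction n rule: Xw.induct)
  case (4 n)
  have "complement (map (\<lambda>c. of_bool (bit_of c)) (Nw n)) =
      map (\<lambda>c. of_bool (bit_of c)) (map flip (Nw n))"
    by (simp add: complement_def of_bool_bit_of_flip)
  then show ?case using 4 by (simp only: Nw_rec Xw.simps map_append)
qed (simp_all add: Nw_0 Nw_Suc)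

lemma aj_eq: "aj k = of_bool (bit_of (nar k))"
  using length_Nw[of k] by (simp add: aj_nth Xw_eq_Nw Nw_nth)

section \<open>Windows of length six and their bits\<close>

definition image_windows :: "letter list \<Rightarrow> letter list list" where
  "image_windows w = [take 6 (subst w), take 6 (drop 1 (subst w))]"

fun explore :: "nat \<Rightarrow> letter list list \<Rightarrow> letter list list \<Rightarrow> letter list list" where
  "explore 0 new seen = seen"
| "explore (Suc n) new seen =
    (let new' = filter (\<lambda>w. \<not> List.member seen w) (remdups (concat (map image_windows new)))
     in explore n new' (new' @ seen))"

text \<open>The search is exhaustive after 14 rounds; \<open>certificate\<close> checks this.\<close>

definition windows6 :: "letter list list" where
  "windows6 =
    (let w = [La False, Lb False, Lc False, La True, La True, Lb True] in explore 14 [w] [w])"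

text \<open>The first two clauses force \<open>F\<close> to contain every window of length six of
  \<open>nar\<close>. The third rules out bit periods 1 and 2; the fourth decodes the letters at
  positions 2, 3 and 4.\<close>

definition certificate :: "letter list list \<Rightarrow> bool" where
  "certificate F \<longleftrightarrow>
     List.member F [La False, Lb False, Lc False, La True, La True, Lb True] \<and>
     list_all (\<lambda>w. length w = 6 \<and> list_all (List.member F) (image_windows w)) F \<and>
     list_all (\<lambda>w. let b = map bit_of w in
       take 4 b \<noteq> take 4 (drop 1 b) \<and> take 3 b \<noteq> take 3 (drop 2 b)) F \<and>
     list_all (\<lambda>v. list_all (\<lambda>w. map bit_of v = map bit_of w \<longrightarrow>
       take 3 (drop 2 v) = take 3 (drop 2 w)) F) F"

lemma certificate_windows6: "certificate windows6"
  by code_simp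

lemma start_in_windows6:
    "[La False, Lb False, Lc False, La True, La True, Lb True] \<in> set windows6"
  and windows6_length: "w \<in> set windows6 \<Longrightarrow> length w = 6"
  and windows6_closed: "w \<in> set windows6 \<Longrightarrow> set (image_windows w) \<subseteq> set windows6"
  and windows6_aperiodic: "w \<in> set windows6 \<Longrightarrow>
    take 4 (map bit_of w) \<noteq> take 4 (drop 1 (map bit_of w)) \<and>
    take 3 (map bit_of w) \<noteq> take 3 (drop 2 (map bit_of w))"
  and windows6_decode: "v \<in> set windows6 \<Longrightarrow> w \<in> set windows6 \<Longrightarrow>
    map bit_of v = map bit_of w \<Longrightarrow> take 3 (drop 2 v) = take 3 (drop 2 w)"
  using certificate_windows6
  unfolding certificate_def list_all_iff Let_def List.member_iff by blast+

lemma window_in_windows6: "map nar [i..<i + 6] \<in> set windows6"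
proof (induction i rule: less_induct)
  case (less i)
  show ?case
  proof (cases "i = 0")
    case True
    have Y: "Nw 4 = [La False, Lb False, Lc False, La True, La True, Lb True]"
      by (simp add: Nw_def eval_nat_numeral)
    then have "map nar [0..<6] = Nw 4" using take_Nw[of 6 4] by simp
    then show ?thesis using start_in_windows6 True Y by simp
  next
    case False
    \<comment> \<open>Blocks have at most two letters, so the window at \<open>i\<close> lies at
      offset 0 or 1 in the image of the window at \<open>k\<close>.\<close>
    obtain k d where k: "i = cut k + d" "d \<le> 1" using cut_cover[of i] by force
    have "k < i"
    proof (cases "k = 0")
      case True
      then show ?thesis using False by simp
    next
      case False
      then show ?thesis using less_cut[of k] k by simp
    qed
    let ?v = "map nar [cut k..<cut (k + 6)]"
    have "set (image_windows (map nar [k..<k + 6])) \<subseteq> set windows6"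
      using less.IH[OF \<open>k < i\<close>] by (rule windows6_closed)
    then have "take 6 (drop d ?v) \<in> set windows6"
      unfolding image_windows_def subst_factor using k(2) by (auto simp: le_Suc_eq)
    \<comment> \<open>Membership gives length six, hence the six image blocks cover the whole window
      at \<open>i\<close>.\<close>
    moreover from this have len: "length (take 6 (drop d ?v)) = 6"
      by (rule windows6_length)
    moreover have "take 6 (drop d ?v) = map nar [i..<i + 6]"
      using len k(1) by (simp add: drop_map take_map)
    ultimately show ?thesis by simp
  qed
qed

lemma bits_determine_letters:
  assumes "\<And>t. t < 6 \<Longrightarrow> bit_of (nar (i + t)) = bit_of (nar (j + t))" "2 \<le> t" "t < 5"
  shows "nar (i + t) = nar (j + t)"
proof -
  let ?v = "map nar [i..<i + 6]" and ?w = "map nar [j..<j + 6]"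
  have "map bit_of ?v = map bit_of ?w"
    using assms(1) by (intro nth_equalityI) auto
  then have "take 3 (drop 2 ?v) = take 3 (drop 2 ?w)"
    by (rule windows6_decode[OF window_in_windows6 window_in_windows6])
  then have "take 3 (drop 2 ?v) ! (t - 2) = take 3 (drop 2 ?w) ! (t - 2)" by simp
  then show ?thesis using assms(2,3) by (auto dest!: le_Suc_ex)
qed

text \<open>Decoding takes six consecutive comparisons and only \<open>p + 3\<close> are given, so
  periods 1 and 2 are checked directly on the windows.\<close>

lemma no_small_bit_period:
  assumes "\<And>t. t < p + 3 \<Longrightarrow> bit_of (nar (i + t)) = bit_of (nar (i + p + t))" "0 < p"
  shows "3 \<le> p"
proof (rule ccontr)
  let ?b = "map bit_of (map nar [i..<i + 6])"
  assume "\<not> 3 \<le> p"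
  then have "p = 1 \<or> p = 2" using assms(2) by auto
  then show False
  proof
    assume p: "p = 1"
    have "take 4 ?b = take 4 (drop 1 ?b)"
      using assms(1) p by (intro nth_equalityI) auto
    then show False using windows6_aperiodic[OF window_in_windows6[of i]] by blast
  next
    assume p: "p = 2"
    have "take 3 ?b = take 3 (drop 2 ?b)"
      using assms(1) p by (intro nth_equalityI) (auto simp: add.assoc)
    then show False using windows6_aperiodic[OF window_in_windows6[of i]] by blast
  qed
qed

text \<open>Of \<open>p + 3\<close> equal pairs of bits, decoding loses two on the left and one on
  the right. The remaining \<open>p\<close> pairs of letters form a square starting at
  \<open>i + 2\<close>.\<close>

lemma bit_run_bound:
  assumes "0 < p"
  shows "\<exists>t < p + 3. bit_of (nar (i + t)) \<noteq> bit_of (nar (i + p + t))"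
proof (rule ccontr)
  assume "\<not> ?thesis"
  then have b: "bit_of (nar (i + t)) = bit_of (nar (i + p + t))" if "t < p + 3" for t
    using that by blast
  have p: "3 \<le> p" using no_small_bit_period[OF b assms] .
  have "run (i + 2) (i + 2 + p) p"
    unfolding run_def
  proof (intro allI impI)
    fix t assume t: "t < p"
    \<comment> \<open>The decoding window is slid left by \<open>d\<close>, just enough to stay
      within the \<open>p + 3\<close> comparisons; the wanted letter is then at position
      \<open>d + 2\<close>, between 2 and 4.\<close>
    define d where "d = (if t + 3 < p then 0 else t + 3 - p)"
    have d: "d \<le> t" "d \<le> 2" "t - d + 6 \<le> p + 3" using t p by (auto simp: d_def)
    have "nar (i + (t - d) + (d + 2)) = nar (i + p + (t - d) + (d + 2))"
    proof (rule bits_determine_letters)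
      fix u :: nat assume "u < 6"
      then show "bit_of (nar (i + (t - d) + u)) = bit_of (nar (i + p + (t - d) + u))"
        using b[of "t - d + u"] d by (simp add: add.assoc)
    qed (use d in auto)
    moreover have "i + (t - d) + (d + 2) = i + 2 + t" "i + p + (t - d) + (d + 2) = i + 2 + p + t"
      using d by auto
    ultimately show "nar (i + 2 + t) = nar (i + 2 + p + t)" by simp
  qed
  \<comment> \<open>The last comparison, \<open>t = p + 2\<close>, concerns exactly the bit
    following the square.\<close>
  from square_right_bit[OF this refl assms] b[of "p + 2"]
  show False by (simp add: ac_simps)
qed

section \<open>Exponents\<close>

theorem factor_period_bound:
  assumes "factor w aj" "has_period w p"
  shows "length w \<le> 2 * p + 2"
proof (rule ccontr)
  assume "\<not> ?thesis"
  \<comment> \<open>Length \<open>2 * p + 3\<close> amounts to \<open>p + 3\<close> comparisons at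
    distance \<open>p\<close>.\<close>
  then have len: "2 * p + 3 \<le> length w" by simp
  obtain i where w: "w = map aj [i..<i + length w]" using assms(1) by (auto simp: factor_def)
  have nth: "w ! t = of_bool (bit_of (nar (i + t)))" if "t < length w" for t
    using that by (subst w) (simp add: aj_eq)
  have p: "0 < p" and per: "take (length w - p) w = drop p w"
    using assms(2) by (auto simp: has_period_def)
  obtain t where t: "t < p + 3" "bit_of (nar (i + t)) \<noteq> bit_of (nar (i + p + t))"
    using bit_run_bound[OF p] by blast
  have "w ! t = take (length w - p) w ! t" using t(1) len by simp
  also have "\<dots> = w ! (p + t)" using t(1) len by (simp add: per)
  finally show False using nth[of t] nth[of "p + t"] t len
    by (auto simp: add.assoc of_bool_def split: if_splits)
qed

section \<open>Factors attaining the bound\<close>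

lemma Xw_nth: "k < length (Xw n) \<Longrightarrow> Xw n ! k = aj k"
  using Xw_prefix[of n "k + 2"] Xw_prefix[of "k + 2" n] length_Xw[of k]
  by (cases "n \<le> k + 2") (auto simp: aj_nth nth_append)

lemma factor_Xw:
  assumes "Xw n = u @ w @ v"
  shows "factor w aj"
proof -
  have "w = map aj [length u..<length u + length w]"
  proof (rule nth_equalityI)
    fix k assume "k < length w"
    then have "w ! k = Xw n ! (length u + k)" "length u + k < length (Xw n)"
      using assms by (simp_all add: nth_append)
    then show "w ! k = map aj [length u..<length u + length w] ! k"
      using \<open>k < length w\<close> by (simp add: Xw_nth)
  qed simp
  then show ?thesis unfolding factor_def by blast
qed

text \<open>Each \<open>Xw (n + 3)\<close> ends in \<open>complement (Xw n)\<close>, so a common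
  suffix is inherited in complemented form when \<open>m\<close> grows by one.\<close>

lemma Xw_common_suffix:
  "\<exists>u v c d. Xw (3 * m + 4) = u @ [c, d] \<and> Xw (3 * m + 5) = v @ [c, d]"
proof (induction m)
  case 0
  have "Xw 4 = [0] @ [1, 1]" "Xw 5 = [0, 1] @ [1, 1]"
    by (simp_all add: eval_nat_numeral)
  then show ?case by fastforce
next
  case (Suc m)
  then obtain u v c d where "Xw (3 * m + 4) = u @ [c, d]" "Xw (3 * m + 5) = v @ [c, d]" by blast
  moreover have "Xw (3 * Suc m + 4) = Xw (3 * m + 6) @ complement (Xw (3 * m + 4))"
    "Xw (3 * Suc m + 5) = Xw (3 * m + 7) @ complement (Xw (3 * m + 5))"
    by (simp_all add: eval_nat_numeral)
  ultimately have "Xw (3 * Suc m + 4) = (Xw (3 * m + 6) @ complement u) @ [1 + c, 1 + d]"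
    "Xw (3 * Suc m + 5) = (Xw (3 * m + 7) @ complement v) @ [1 + c, 1 + d]"
    by simp_all
  then show ?case by blast
qed

lemma has_period_square_with_suffix:
  assumes "s \<noteq> []"
  shows "has_period (s @ (v @ s) @ (v @ s)) (length (v @ s))"
proof -
  have "s @ (v @ s) @ (v @ s) = (s @ v @ s) @ v @ s"
    "s @ (v @ s) @ (v @ s) = (s @ v) @ s @ v @ s" by simp_all
  then have "take (length (s @ v @ s)) (s @ (v @ s) @ (v @ s)) = s @ v @ s"
    "drop (length (s @ v)) (s @ (v @ s) @ (v @ s)) = s @ v @ s"
    by (metis append_eq_conv_conj)+
  then show ?thesis using assms by (cases s) (simp_all add: has_period_def add.commute)
qed

theorem long_factor_with_period:
  "\<exists>w p. N \<le> length w \<and> factor w aj \<and> has_period w p \<and> length w = 2 * p + 2"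
proof -
  obtain u v c d where u: "Xw (3 * N + 4) = u @ [c, d]" and v: "Xw (3 * N + 5) = v @ [c, d]"
    using Xw_common_suffix by blast
  define X where "X = complement (Xw (3 * N + 5))"
  define w where "w = complement [c, d] @ X @ X"
  \<comment> \<open>The recurrence is unfolded down to \<open>Xw (3 * N + 6)\<close>, and once more
    inside the last complement; that yields the second \<open>X\<close>.\<close>
  have "Xw (3 * N + 9) = Xw (3 * N + 6) @ complement (Xw (3 * N + 4)) @ X @ X @
      complement (complement (Xw (3 * N + 3)))"
    by (simp add: eval_nat_numeral X_def)
  also have "\<dots> = (Xw (3 * N + 6) @ complement u) @ w @ complement (complement (Xw (3 * N + 3)))"
    by (simp add: u w_def)
  finally have "factor w aj" by (rule factor_Xw)
  moreover have "has_period w (length X)"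
    using has_period_square_with_suffix[of "complement [c, d]" "complement v"]
    by (simp add: w_def X_def v)
  moreover have "length w = 2 * length X + 2" by (simp add: w_def)
  moreover have "N \<le> length w"
    using length_Xw[of "3 * N + 3"] by (simp add: w_def X_def ac_simps)
  ultimately show ?thesis by blast
qed

section \<open>The critical exponent\<close>

lemma has_period_length: "w \<noteq> [] \<Longrightarrow> has_period w (length w)"
  by (cases w) (auto simp: has_period_def)

lemma has_period_Least: "w \<noteq> [] \<Longrightarrow> has_period w (LEAST p. has_period w p)"
  by (rule LeastI[of _ "length w"]) (rule has_period_length)

lemma exponent_eq:
  assumes "has_period w p" "\<And>q. has_period w q \<Longrightarrow> p \<le> q"
  shows "exponent w = real (length w) / real p"
  unfolding exponent_def by (subst Least_equality[of "has_period w" p]) (use assms in auto)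

lemma factor_exponent:
  assumes "factor w aj"
  shows "exponent w \<le> 4" and "exponent w = 4 \<Longrightarrow> w = [0, 0, 0, 0] \<or> w = [1, 1, 1, 1]"
proof -
  define p where "p = (LEAST p. has_period w p)"
  have exp: "exponent w = length w / p" by (simp add: exponent_def p_def)
  have "exponent w \<le> 4 \<and> (exponent w = 4 \<longrightarrow> w = [0, 0, 0, 0] \<or> w = [1, 1, 1, 1])"
  proof (cases "w = []")
    case True
    then show ?thesis by (simp add: exponent_def)
  next
    case False
    then have per: "has_period w p" unfolding p_def by (rule has_period_Least)
    then have p: "1 \<le> p" by (simp add: has_period_def)
    have len: "length w \<le> 2 * p + 2" using factor_period_bound[OF assms per] .
    then have "real (length w) \<le> 4 * real p" using p by simp
    then have "exponent w \<le> 4" using p by (simp add: exp field_simps)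
    moreover have "w = [0, 0, 0, 0] \<or> w = [1, 1, 1, 1]" if "exponent w = 4"
    proof -
      have "real (length w) = 4 * real p" using that p by (simp add: exp field_simps)
      then have "length w = 4 * p" by linarith
      \<comment> \<open>\<open>4 * p \<le> 2 * p + 2\<close> leaves only
        \<open>p = 1\<close>.\<close>
      then have l: "length w = 4" and p1: "p = 1" using len p by linarith+
      from l obtain a b c d where w: "w = [a, b, c, d]"
        by (auto simp: eval_nat_numeral length_Suc_conv)
      have "a = b" "b = c" "c = d" using per by (simp_all add: has_period_def w p1)
      then show ?thesis using w by (cases a) auto
    qed
    ultimately show ?thesis by blast
  qed
  then show "exponent w \<le> 4" "exponent w = 4 \<Longrightarrow> w = [0, 0, 0, 0] \<or> w = [1, 1, 1, 1]"
    by blast+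
qed

lemma exponent_constant: "exponent [a, a, a, a] = 4"
  by (subst exponent_eq[of _ 1]) (auto simp: has_period_def)

lemma factor_1111: "factor [1, 1, 1, 1] aj"
  by (rule factor_Xw[of 6 "[0]" _ "[0]"]) (simp add: eval_nat_numeral)

text \<open>\<open>Xw 9\<close> ends in \<open>complement (Xw 6)\<close>, and \<open>Xw 6\<close>
  contains \<open>1111\<close>.\<close>

lemma factor_0000: "factor [0, 0, 0, 0] aj"
  by (rule factor_Xw[of 9 "[0, 1, 1, 1, 1, 0, 1, 0, 0, 1, 0, 0, 0, 1]" _ "[1]"])
    (simp add: eval_nat_numeral)


lemma critical_exponent_aj: "critical_exponent aj = 4"
  unfolding critical_exponent_def
proof (rule antisym)
  show "(SUP w \<in> {w. factor w aj \<and> w \<noteq> []}. ereal (exponent w)) \<le> 4"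
    by (rule SUP_least) (use factor_exponent(1) in auto)
  have "ereal (exponent [1, 1, 1, 1 :: bit]) \<le>
      (SUP w \<in> {w. factor w aj \<and> w \<noteq> []}. ereal (exponent w))"
    by (rule SUP_upper) (simp add: factor_1111)
  then show "4 \<le> (SUP w \<in> {w. factor w aj \<and> w \<noteq> []}. ereal (exponent w))"
    by (simp add: exponent_constant)
qed

section \<open>The asymptotic critical exponent\<close>

lemma min_factor_period:
  assumes "0 < n"
  shows "\<exists>w. factor w aj \<and> length w = n \<and> has_period w (min_factor_period aj n)"
proof -
  let ?w = "map aj [0..<n]"
  have "factor ?w aj" unfolding factor_def by (rule exI[of _ 0]) simp
  moreover have "has_period ?w n" using has_period_length[of ?w] assms by simp
  ultimately have "\<exists>w. factor w aj \<and> length w = n \<and> has_period w n"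
    by (intro exI[of _ ?w]) simp
  then show ?thesis unfolding min_factor_period_def by (rule LeastI)
qed

lemma asymptotic_critical_exponent_aj: "asymptotic_critical_exponent aj = 2"
  unfolding asymptotic_critical_exponent_def
proof (rule antisym)
  let ?r = "\<lambda>n. real n / real (min_factor_period aj n)"
  \<comment> \<open>The period bound gives \<open>2 * n / (n - 2) = 2 + 4 / (n - 2)\<close>, and
    \<open>4 / (n - 2) \<le> 12 / n\<close> holds exactly from \<open>n = 3\<close> on.\<close>
  have le: "ereal (?r n) \<le> ereal (2 + 12 / real n)" if n: "3 \<le> n" for n
  proof -
    obtain w where w: "factor w aj" "length w = n" "has_period w (min_factor_period aj n)"
      using min_factor_period[of n] n by auto
    have "n \<le> 2 * min_factor_period aj n + 2" using factor_period_bound[OF w(1,3)] w(2) by simp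
    then have "real n \<le> 2 * real (min_factor_period aj n) + 2" by linarith
    then have "?r n \<le> real n / ((real n - 2) / 2)"
      using n by (intro divide_left_mono) auto
    also have "\<dots> \<le> 2 + 12 / real n" using n by (simp add: field_simps)
    finally show ?thesis by simp
  qed
  have "limsup (\<lambda>n. ereal (?r n)) \<le> limsup (\<lambda>n. ereal (2 + 12 / real n))"
    by (rule Limsup_mono) (use le in \<open>auto simp: eventually_sequentially\<close>)
  also have "\<dots> = ereal 2"
  proof (rule lim_imp_Limsup)
    show "(\<lambda>n. ereal (2 + 12 / real n)) \<longlonglongrightarrow> ereal 2"
      unfolding lim_ereal using tendsto_add[OF tendsto_const lim_const_over_n, of 2 12] by simp
  qed simp
  finally show "limsup (\<lambda>n. ereal (?r n)) \<le> 2" by simp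
  show "2 \<le> limsup (\<lambda>n. ereal (?r n))"
    unfolding limsup_INF_SUP
  proof (rule INF_greatest)
    fix N :: nat
    obtain w p where w: "N + 3 \<le> length w" "factor w aj" "has_period w p" "length w = 2 * p + 2"
      using long_factor_with_period by blast
    have "min_factor_period aj (length w) \<le> p"
      unfolding min_factor_period_def by (rule Least_le) (use w in blast)
    moreover have "0 < min_factor_period aj (length w)"
    proof -
      have "0 < length w" using w(1) by linarith
      from min_factor_period[OF this] show ?thesis by (auto simp: has_period_def)
    qed
    ultimately have "2 \<le> ?r (length w)" using w(4) by (simp add: field_simps)
    then have "ereal 2 \<le> ereal (?r (length w))" by simp
    also have "\<dots> \<le> (SUP n\<in>{N..}. ereal (?r n))" by (rule SUP_upper) (use w in auto)
    finally show "2 \<le> (SUP n\<in>{N..}. ereal (?r n))" by simp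
  qed
qed

theorem theorem41:
  shows "critical_exponent aj = 4
    \<and> {w. factor w aj \<and> exponent w = 4} = {[0, 0, 0, 0], [1, 1, 1, 1]}
    \<and> asymptotic_critical_exponent aj = 2
    \<and> (\<forall>w p. factor w aj \<and> has_period w p \<longrightarrow> length w \<le> 2 * p + 2)
    \<and> (\<forall>N. \<exists>w p. length w \<ge> N \<and> factor w aj \<and> has_period w p \<and> length w = 2 * p + 2)"
proof (intro conjI)
  show "{w. factor w aj \<and> exponent w = 4} = {[0, 0, 0, 0], [1, 1, 1, 1]}"
    by (auto simp: factor_0000 factor_1111 exponent_constant dest: factor_exponent(2))
  show "\<forall>w p. factor w aj \<and> has_period w p \<longrightarrow> length w \<le> 2 * p + 2"
    using factor_period_bound by blast
  show "\<forall>N. \<exists>w p. length w \<ge> N \<and> factor w aj \<and> has_period w p \<and> length w = 2 * p + 2"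
    using long_factor_with_period by blast
qed (rule critical_exponent_aj asymptotic_critical_exponent_aj)+

end
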